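(* Let $A,B\in\mathcal{M}_n$ be two accretive matrices. If $0\le t\le 1$, then $$\mathfrak{R}(A!_tB)\ \ge\ \Big(\big((\mathfrak{R}A)!_t(\mathfrak{R}B)\big)^{-1}-2r\big(\big((\mathfrak{R}A)!(\mathfrak{R}B)\big)^{-1}-\big(\mathfrak{R}(A!B)\big)^{-1}\big)\Big)^{-1}\ \ge\ (\mathfrak{R}A)!_t(\mathfrak{R}B),$$ where $r=\min\{t,1-t\}$.
   Context: $\mathcal{M}_n$ is the algebra of complex $n\times n$ matrices; $\mathfrak{R}A=\frac{A+A^*}{2}$; $A$ is accretive if $\mathfrak{R}A>0$ (positive definite). Inequalities between Hermitian matrices are in the Loewner (positive semidefinite) order. The weighted harmonic mean is $A!_tB=((1-t)A^{-1}+tB^{-1})^{-1}$, and $!=\,!_{1/2}$. *)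

theory Defs
  imports "HOL-Analysis.Analysis"
begin

definition conj_transpose :: "complex ^ 'n ^ 'n \<Rightarrow> complex ^ 'n ^ 'n" where
  "conj_transpose A = (\<chi> i j. cnj (A $ j $ i))"

definition hermitian :: "complex ^ 'n ^ 'n \<Rightarrow> bool" where
  "hermitian A \<longleftrightarrow> conj_transpose A = A"

definition real_part :: "complex ^ 'n ^ 'n \<Rightarrow> complex ^ 'n ^ 'n" where
  "real_part A = (1 / 2) *\<^sub>R (A + conj_transpose A)"

definition quad_form :: "complex ^ 'n ^ 'n \<Rightarrow> complex ^ 'n \<Rightarrow> complex" where
  "quad_form A x = (\<Sum>i\<in>UNIV. cnj (x $ i) * (A *v x) $ i)"

text \<open>For a Hermitian matrix the quadratic form is real-valued, so taking \<open>Re\<close> loses nothing.\<close>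

definition pos_semidef :: "complex ^ 'n ^ 'n \<Rightarrow> bool" where
  "pos_semidef A \<longleftrightarrow> hermitian A \<and> (\<forall>x. 0 \<le> Re (quad_form A x))"

definition pos_def :: "complex ^ 'n ^ 'n \<Rightarrow> bool" where
  "pos_def A \<longleftrightarrow> hermitian A \<and> (\<forall>x. x \<noteq> 0 \<longrightarrow> 0 < Re (quad_form A x))"

definition loewner_le :: "complex ^ 'n ^ 'n \<Rightarrow> complex ^ 'n ^ 'n \<Rightarrow> bool"
    (infix \<open>\<le>\<^sub>L\<close> 50) where
  "A \<le>\<^sub>L B \<longleftrightarrow> pos_semidef (B - A)"

definition accretive :: "complex ^ 'n ^ 'n \<Rightarrow> bool" where
  "accretive A \<longleftrightarrow> pos_def (real_part A)"

text \<open>\<open>matrix_inv\<close> is the actual inverse only on invertible matrices. For accretive \<open>A\<close>, \<open>B\<close>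
  and \<open>0 \<le> t \<le> 1\<close>, the matrices \<open>A\<close>, \<open>B\<close> and \<open>(1 - t) A\<inverse> + t B\<inverse>\<close> are all invertible.\<close>

definition wharm_mean :: "real \<Rightarrow> complex ^ 'n ^ 'n \<Rightarrow> complex ^ 'n ^ 'n \<Rightarrow> complex ^ 'n ^ 'n" where
  "wharm_mean t A B = matrix_inv ((1 - t) *\<^sub>R matrix_inv A + t *\<^sub>R matrix_inv B)"

abbreviation harm_mean :: "complex ^ 'n ^ 'n \<Rightarrow> complex ^ 'n ^ 'n \<Rightarrow> complex ^ 'n ^ 'n" where
  "harm_mean \<equiv> wharm_mean (1 / 2)"

end

theory Submission
  imports Defs
begin

text \<open>
  For accretive \<open>M\<close> put \<open>g M = (\<Re> (M\<inverse>))\<inverse>\<close>. The Hermitian form of \<open>g M\<close> at \<open>x\<close> equals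
  the maximum over \<open>w\<close> of \<open>2 Re \<langle>M w, x\<rangle> - Re \<langle>w, M w\<rangle>\<close>, a supremum of functions affine in \<open>M\<close>,
  so \<open>g\<close> is convex in the Loewner order. Hence \<open>f s = g ((1 - s) A\<inverse> + s B\<inverse>)\<close>, the inverse of
  \<open>\<Re> (A !\<^sub>s B)\<close>, is convex in \<open>s\<close>, and the matrix inverted in the middle term is
  \<open>(1 - t) f 0 + t f 1 - 2 r ((f 0 + f 1) / 2 - f (1/2))\<close>: the linear interpolation of
  \<open>f\<close> between \<open>1/2\<close> and the endpoint nearer to \<open>t\<close>. It lies between \<open>f t\<close> and the chord
  \<open>(1 - t) f 0 + t f 1\<close>, and inversion is antitone.
\<close>

text \<open>On \<^typ>\<open>complex ^ 'n\<close> the real inner product \<open>x \<bullet> y\<close> is the real part of the Hermitian one.\<close>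

lemma Re_quad_form: "Re (quad_form A x) = x \<bullet> (A *v x)"
  by (simp add: quad_form_def inner_vec_def inner_complex_def)

lemma inner_conj_transpose: "x \<bullet> (conj_transpose A *v y) = (A *v x) \<bullet> y"
proof -
  have "x \<bullet> (conj_transpose A *v y) = (\<Sum>i\<in>UNIV. \<Sum>j\<in>UNIV. Re (cnj (x $ i) * cnj (A $ j $ i) * y $ j))"
    by (simp add: inner_vec_def inner_complex_def matrix_vector_mult_def conj_transpose_def
        sum_distrib_left algebra_simps sum.distrib sum_subtractf)
  also have "\<dots> = (\<Sum>j\<in>UNIV. \<Sum>i\<in>UNIV. Re (cnj (x $ i) * cnj (A $ j $ i) * y $ j))"
    by (rule sum.swap)
  also have "\<dots> = (A *v x) \<bullet> y"
    by (simp add: inner_vec_def inner_complex_def matrix_vector_mult_def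
        sum_distrib_left sum_distrib_right algebra_simps sum.distrib sum_subtractf)
  finally show ?thesis .
qed

lemma scaleR_matrix_vector_mult: "(c *\<^sub>R A) *v x = c *\<^sub>R (A *v x)" for A :: "complex ^ 'n ^ 'm"
  by (simp add: matrix_vector_mult_def vec_eq_iff scaleR_sum_right)

lemmas matrix_vector_linear_simps =
  matrix_vector_mult_add_rdistrib matrix_vector_mult_diff_rdistrib scaleR_matrix_vector_mult
  inner_add_right inner_diff_right

lemma conj_transpose_add: "conj_transpose (A + B) = conj_transpose A + conj_transpose B"
  and conj_transpose_diff: "conj_transpose (A - B) = conj_transpose A - conj_transpose B"
  and conj_transpose_scaleR: "conj_transpose (c *\<^sub>R A) = c *\<^sub>R conj_transpose A"
  and conj_transpose_conj_transpose: "conj_transpose (conj_transpose A) = A"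
  and conj_transpose_mat_1: "conj_transpose (mat 1) = mat 1"
  by (auto simp: conj_transpose_def vec_eq_iff mat_def)

lemma conj_transpose_mult: "conj_transpose (A ** B) = conj_transpose B ** conj_transpose A"
  by (simp add: conj_transpose_def vec_eq_iff matrix_matrix_mult_def mult.commute)

lemma hermitian_add: "hermitian A \<Longrightarrow> hermitian B \<Longrightarrow> hermitian (A + B)"
  and hermitian_diff: "hermitian A \<Longrightarrow> hermitian B \<Longrightarrow> hermitian (A - B)"
  and hermitian_scaleR: "hermitian A \<Longrightarrow> hermitian (c *\<^sub>R A)"
  by (auto simp: hermitian_def conj_transpose_add conj_transpose_diff conj_transpose_scaleR)

lemma hermitian_real_part: "hermitian (real_part A)"
  by (simp add: real_part_def hermitian_def conj_transpose_scaleR conj_transpose_add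
      conj_transpose_conj_transpose add.commute)

lemma inner_hermitian: "hermitian A \<Longrightarrow> x \<bullet> (A *v y) = (A *v x) \<bullet> y"
  by (metis hermitian_def inner_conj_transpose)

text \<open>The skew-Hermitian part of \<open>A\<close> contributes a purely imaginary value to the
  Hermitian form, which the real inner product discards. Accretivity can therefore be tested on
  \<open>A\<close> itself.\<close>

lemma inner_real_part: "x \<bullet> (real_part A *v x) = x \<bullet> (A *v x)"
  by (simp add: real_part_def matrix_vector_linear_simps inner_conj_transpose inner_commute)

lemma pos_def_iff: "pos_def A \<longleftrightarrow> hermitian A \<and> (\<forall>x. x \<noteq> 0 \<longrightarrow> 0 < x \<bullet> (A *v x))"
  by (simp add: pos_def_def Re_quad_form)

lemma accretive_iff: "accretive A \<longleftrightarrow> (\<forall>x. x \<noteq> 0 \<longrightarrow> 0 < x \<bullet> (A *v x))"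
  by (simp add: accretive_def pos_def_iff hermitian_real_part inner_real_part)

lemma pos_def_imp_accretive: "pos_def A \<Longrightarrow> accretive A"
  by (simp add: pos_def_iff accretive_iff)

lemma loewner_le_iff:
  "hermitian A \<Longrightarrow> hermitian B \<Longrightarrow> A \<le>\<^sub>L B \<longleftrightarrow> (\<forall>x. x \<bullet> (A *v x) \<le> x \<bullet> (B *v x))"
  by (simp add: loewner_le_def pos_semidef_def hermitian_diff Re_quad_form matrix_vector_linear_simps)

text \<open>A nonzero kernel vector would make the form vanish there, against strict
  positivity.\<close>

lemma invertible_accretive:
  assumes "accretive A"
  shows "invertible A"
proof -
  have "\<forall>x. A *v x = 0 \<longrightarrow> x = 0"
    using assms unfolding accretive_iff by (metis inner_zero_right less_irrefl)
  then show ?thesis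
    by (simp add: invertible_left_inverse matrix_left_invertible_ker)
qed

lemma matrix_inv:
  fixes A :: "'a::semiring_1 ^ 'n ^ 'm"
  assumes "invertible A"
  shows matrix_inv_right: "A ** matrix_inv A = mat 1"
    and matrix_inv_left: "matrix_inv A ** A = mat 1"
  using someI_ex[OF assms[unfolded invertible_def]] by (simp_all add: matrix_inv_def)

lemma matrix_inv_unique:
  fixes A :: "'a::semiring_1 ^ 'n ^ 'n"
  assumes "A ** B = mat 1" "B ** A = mat 1"
  shows "matrix_inv A = B"
  using assms
  by (metis invertible_def matrix_inv_left matrix_mul_assoc matrix_mul_lid matrix_mul_rid)

lemma matrix_inv_matrix_inv: "invertible A \<Longrightarrow> matrix_inv (matrix_inv A) = A"
  for A :: "'a::semiring_1 ^ 'n ^ 'n"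
  by (metis matrix_inv_left matrix_inv_right matrix_inv_unique)

lemma matrix_vector_mult_matrix_inv:
  fixes A :: "'a::field ^ 'n ^ 'n"
  assumes "invertible A"
  shows "A *v (matrix_inv A *v x) = x" and "matrix_inv A *v (A *v x) = x"
  using assms by (simp_all add: matrix_vector_mul_assoc matrix_inv_left matrix_inv_right)

text \<open>With \<open>x = A *v w\<close>, symmetry of the real inner product turns the form of the
  inverse at \<open>x\<close> into the form of \<open>A\<close> at \<open>w\<close>.\<close>

lemma accretive_matrix_inv:
  fixes A :: "complex ^ 'n ^ 'n"
  assumes "accretive A"
  shows "accretive (matrix_inv A)"
  unfolding accretive_iff
proof (intro allI impI)
  fix x :: "complex ^ 'n" assume "x \<noteq> 0"
  define w where "w = matrix_inv A *v x"
  have x: "x = A *v w"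
    using invertible_accretive[OF assms] by (simp add: w_def matrix_vector_mult_matrix_inv)
  with \<open>x \<noteq> 0\<close> have "w \<noteq> 0" by auto
  then have "0 < w \<bullet> (A *v w)" using assms by (simp add: accretive_iff)
  then show "0 < x \<bullet> (matrix_inv A *v x)"
    by (simp add: w_def[symmetric] x[symmetric] inner_commute)
qed

lemma accretive_convex:
  fixes A B :: "complex ^ 'n ^ 'n"
  assumes "accretive A" "accretive B" "0 \<le> t" "t \<le> 1"
  shows "accretive ((1 - t) *\<^sub>R A + t *\<^sub>R B)"
  unfolding accretive_iff
proof (intro allI impI)
  fix x :: "complex ^ 'n" assume "x \<noteq> 0"
  then have "0 < x \<bullet> (A *v x)" "0 < x \<bullet> (B *v x)"
    using assms by (auto simp: accretive_iff)
  then have "0 < (1 - t) * (x \<bullet> (A *v x)) + t * (x \<bullet> (B *v x))"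
    using assms(3,4) by (cases "t = 0") (auto intro: add_nonneg_pos)
  then show "0 < x \<bullet> (((1 - t) *\<^sub>R A + t *\<^sub>R B) *v x)"
    by (simp add: matrix_vector_linear_simps)
qed

lemma hermitian_matrix_inv:
  assumes "hermitian A" "invertible A"
  shows "hermitian (matrix_inv A)"
proof -
  have "A ** conj_transpose (matrix_inv A) = mat 1" "conj_transpose (matrix_inv A) ** A = mat 1"
    using assms
    by (metis conj_transpose_mult hermitian_def matrix_inv_left matrix_inv_right conj_transpose_mat_1)+
  then show ?thesis
    unfolding hermitian_def by (metis matrix_inv_unique)
qed

lemma pos_def_matrix_inv: "pos_def A \<Longrightarrow> pos_def (matrix_inv A)"
  using accretive_matrix_inv hermitian_matrix_inv invertible_accretive pos_def_imp_accretive
  unfolding pos_def_iff accretive_iff by metis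

text \<open>Completing the square: the right side minus the left side is the form of
  \<open>P\<close> at \<open>w - matrix_inv P *v x\<close>. Equality holds at
  \<open>w = matrix_inv P *v x\<close>.\<close>

lemma inner_matrix_inv_ge:
  assumes "pos_def P"
  shows "2 * (w \<bullet> x) - w \<bullet> (P *v w) \<le> x \<bullet> (matrix_inv P *v x)"
proof -
  define u where "u = matrix_inv P *v x"
  have P: "hermitian P" and Pu: "P *v u = x"
    using assms invertible_accretive[OF pos_def_imp_accretive[OF assms]]
    by (simp_all add: pos_def_def u_def matrix_vector_mult_matrix_inv)
  have "0 \<le> (w - u) \<bullet> (P *v (w - u))"
    using assms by (cases "w = u") (auto simp: pos_def_iff less_imp_le)
  also have "\<dots> = w \<bullet> (P *v w) - 2 * (w \<bullet> x) + x \<bullet> u"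
    using inner_hermitian[OF P, of u w]
    by (simp add: matrix_vector_mult_diff_distrib inner_diff_left inner_diff_right Pu inner_commute)
  finally show ?thesis by (simp add: u_def)
qed

text \<open>In the variational expression for \<open>Q\<close>, take the maximizer \<open>w\<close>.
  Replacing \<open>Q\<close> by the smaller \<open>P\<close> can only raise the value, which is
  still bounded by the form of \<open>matrix_inv P\<close>.\<close>

lemma matrix_inv_antimono:
  assumes "pos_def P" "pos_def Q" "\<And>x. x \<bullet> (P *v x) \<le> x \<bullet> (Q *v x)"
  shows "matrix_inv Q \<le>\<^sub>L matrix_inv P"
proof -
  have "x \<bullet> (matrix_inv Q *v x) \<le> x \<bullet> (matrix_inv P *v x)" for x
  proof -
    define w where "w = matrix_inv Q *v x"
    have "Q *v w = x"
      using invertible_accretive[OF pos_def_imp_accretive[OF assms(2)]]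
      by (simp add: w_def matrix_vector_mult_matrix_inv)
    then have "x \<bullet> (matrix_inv Q *v x) = 2 * (w \<bullet> x) - w \<bullet> (Q *v w)"
      by (simp add: w_def[symmetric] inner_commute)
    also have "\<dots> \<le> x \<bullet> (matrix_inv P *v x)"
      using inner_matrix_inv_ge[OF assms(1), of w x] assms(3)[of w] by simp
    finally show ?thesis .
  qed
  then show ?thesis
    using assms(1,2)[THEN pos_def_matrix_inv] by (simp add: loewner_le_iff pos_def_iff)
qed

text \<open>The map \<open>g\<close> of the overview. At \<open>M = matrix_inv A\<close> with
  \<open>A\<close> invertible it gives the inverse of \<open>real_part A\<close>.\<close>

definition inv_re_inv :: "complex ^ 'n ^ 'n \<Rightarrow> complex ^ 'n ^ 'n" where
  "inv_re_inv M = matrix_inv (real_part (matrix_inv M))"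

lemma pos_def_inv_re_inv: "accretive M \<Longrightarrow> pos_def (inv_re_inv M)"
  unfolding inv_re_inv_def
  using accretive_matrix_inv accretive_def pos_def_matrix_inv by blast

text \<open>Using \<open>M *v w\<close> as the trial vector cancels the inverse in the quadratic
  term, so for fixed \<open>w\<close> and \<open>x\<close> the bound becomes affine in
  \<open>M\<close>.\<close>

lemma inner_inv_re_inv_ge:
  assumes "accretive M"
  shows "2 * ((M *v w) \<bullet> x) - w \<bullet> (M *v w) \<le> x \<bullet> (inv_re_inv M *v x)"
proof -
  have "pos_def (real_part (matrix_inv M))"
    using accretive_matrix_inv[OF assms] by (simp add: accretive_def)
  from inner_matrix_inv_ge[OF this, of "M *v w" x] show ?thesis
    using invertible_accretive[OF assms]
    by (simp add: inv_re_inv_def inner_real_part matrix_vector_mult_matrix_inv inner_commute)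
qed

lemma inner_inv_re_inv_attained:
  assumes "accretive M"
  obtains w where "x \<bullet> (inv_re_inv M *v x) = 2 * ((M *v w) \<bullet> x) - w \<bullet> (M *v w)"
proof
  let ?P = "real_part (matrix_inv M)"
  \<comment> \<open>\<open>?u\<close> is the maximizer for the inverse of \<open>?P\<close>; since
    trial vectors now have the form \<open>M *v w\<close>, the witness is
    \<open>matrix_inv M *v ?u\<close>.\<close>
  let ?u = "matrix_inv ?P *v x"
  have M: "invertible M" "invertible ?P"
    using assms accretive_matrix_inv[OF assms]
    by (auto simp: accretive_def intro: invertible_accretive pos_def_imp_accretive)
  have "(matrix_inv M *v ?u) \<bullet> ?u = ?u \<bullet> (?P *v ?u)"
    by (simp add: inner_real_part inner_commute)
  then show "x \<bullet> (inv_re_inv M *v x) = 2 * ((M *v (matrix_inv M *v ?u)) \<bullet> x)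
      - (matrix_inv M *v ?u) \<bullet> (M *v (matrix_inv M *v ?u))"
    using M by (simp add: inv_re_inv_def matrix_vector_mult_matrix_inv inner_commute)
qed

lemma inv_re_inv_convex:
  assumes "accretive M" "accretive N" "0 \<le> s" "s \<le> 1"
  shows "x \<bullet> (inv_re_inv ((1 - s) *\<^sub>R M + s *\<^sub>R N) *v x)
    \<le> (1 - s) * (x \<bullet> (inv_re_inv M *v x)) + s * (x \<bullet> (inv_re_inv N *v x))"
proof -
  let ?L = "(1 - s) *\<^sub>R M + s *\<^sub>R N"
  \<comment> \<open>This \<open>w\<close> is optimal for the combination \<open>?L\<close>; for
    \<open>M\<close> and \<open>N\<close> separately it is merely a trial vector, which gives the
    inequality.\<close>
  obtain w where "x \<bullet> (inv_re_inv ?L *v x) = 2 * ((?L *v w) \<bullet> x) - w \<bullet> (?L *v w)"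
    using inner_inv_re_inv_attained[OF accretive_convex[OF assms]] .
  also have "\<dots> = (1 - s) * (2 * ((M *v w) \<bullet> x) - w \<bullet> (M *v w))
      + s * (2 * ((N *v w) \<bullet> x) - w \<bullet> (N *v w))"
    by (simp add: matrix_vector_linear_simps inner_add_left algebra_simps)
  also have "\<dots> \<le> (1 - s) * (x \<bullet> (inv_re_inv M *v x)) + s * (x \<bullet> (inv_re_inv N *v x))"
    using assms by (intro add_mono mult_left_mono inner_inv_re_inv_ge) auto
  finally show ?thesis .
qed

theorem theorem2p3:
  fixes A B :: "complex ^ 'n ^ 'n" and t r :: real
  assumes "accretive A" and "accretive B"
    and "0 \<le> t" and "t \<le> 1"
    and "r = min t (1 - t)"
  shows "wharm_mean t (real_part A) (real_part B)
           \<le>\<^sub>L matrix_inv (matrix_inv (wharm_mean t (real_part A) (real_part B))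
                 - (2 * r) *\<^sub>R (matrix_inv (harm_mean (real_part A) (real_part B))
                                - matrix_inv (real_part (harm_mean A B))))
       \<and> matrix_inv (matrix_inv (wharm_mean t (real_part A) (real_part B))
                 - (2 * r) *\<^sub>R (matrix_inv (harm_mean (real_part A) (real_part B))
                                - matrix_inv (real_part (harm_mean A B))))
           \<le>\<^sub>L real_part (wharm_mean t A B)"
proof -
  define M where "M s = (1 - s) *\<^sub>R matrix_inv A + s *\<^sub>R matrix_inv B" for s
  define f where "f s = inv_re_inv (M s)" for s
  define q where "q s x = x \<bullet> (f s *v x)" for s x
  \<comment> \<open>The lower and middle terms of the chain will be \<open>matrix_inv C\<close> and
    \<open>matrix_inv D\<close>, so the goal reduces to comparing the forms of \<open>f t\<close>,
    \<open>D\<close> and \<open>C\<close>.\<close>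
  define C where "C = (1 - t) *\<^sub>R f 0 + t *\<^sub>R f 1"
  define D where "D = C - (2 * r) *\<^sub>R ((1/2) *\<^sub>R f 0 + (1/2) *\<^sub>R f 1 - f (1/2))"
  have invs: "invertible A" "invertible B"
    using assms invertible_accretive by auto
  have M: "accretive (M s)" if "0 \<le> s" "s \<le> 1" for s
    unfolding M_def using that assms by (intro accretive_convex accretive_matrix_inv)
  have f: "pos_def (f s)" if "0 \<le> s" "s \<le> 1" for s
    unfolding f_def using that M by (intro pos_def_inv_re_inv)
  have f_eq: "f s = matrix_inv (real_part (wharm_mean s A B))" for s
    by (simp add: f_def inv_re_inv_def M_def wharm_mean_def)
  have inv_f: "matrix_inv (f s) = real_part (wharm_mean s A B)" if "0 \<le> s" "s \<le> 1" for s
  proof -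
    have "invertible (real_part (wharm_mean s A B))"
      using accretive_matrix_inv[OF M[OF that]]
      by (auto simp: M_def wharm_mean_def accretive_def intro: invertible_accretive pos_def_imp_accretive)
    then show ?thesis by (simp add: f_eq matrix_inv_matrix_inv)
  qed
  have endpoints: "f 0 = matrix_inv (real_part A)" "f 1 = matrix_inv (real_part B)"
    using invs by (simp_all add: f_eq wharm_mean_def matrix_inv_matrix_inv)
  \<comment> \<open>The weighted harmonic mean of the real parts is the inverse of a point on the
    chord from \<open>f 0\<close> to \<open>f 1\<close>.\<close>
  have wharm: "matrix_inv (wharm_mean s (real_part A) (real_part B)) = (1 - s) *\<^sub>R f 0 + s *\<^sub>R f 1"
    if "0 \<le> s" "s \<le> 1" for s
    unfolding wharm_mean_def endpoints[symmetric] using f[of 0] f[of 1] that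
    by (intro matrix_inv_matrix_inv invertible_accretive accretive_convex pos_def_imp_accretive) auto
  have convex: "q ((1 - s) * a + s * b) x \<le> (1 - s) * q a x + s * q b x"
    if "0 \<le> a" "a \<le> 1" "0 \<le> b" "b \<le> 1" "0 \<le> s" "s \<le> 1" for a b s x
  proof -
    \<comment> \<open>As \<open>M\<close> is affine in its parameter, convexity of
      \<open>inv_re_inv\<close> passes to the scalar function \<open>q\<close> for each fixed
      \<open>x\<close>.\<close>
    have "M ((1 - s) * a + s * b) = (1 - s) *\<^sub>R M a + s *\<^sub>R M b"
      by (simp add: M_def algebra_simps)
    then show ?thesis
      using inv_re_inv_convex[OF M M, of a b s x] that by (simp add: q_def f_def)
  qed
  have qC: "x \<bullet> (C *v x) = (1 - t) * q 0 x + t * q 1 x" for x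
    by (simp add: C_def q_def matrix_vector_linear_simps)
  have qD: "x \<bullet> (D *v x) = x \<bullet> (C *v x) - 2 * r * ((q 0 x + q 1 x) / 2 - q (1/2) x)" for x
    by (simp add: D_def q_def matrix_vector_linear_simps algebra_simps)
  have "0 \<le> r" using assms by simp
  have D_le_C: "x \<bullet> (D *v x) \<le> x \<bullet> (C *v x)" for x
  proof -
    \<comment> \<open>Midpoint convexity makes the bracket nonnegative, so subtracting
      \<open>2 * r\<close> times it lowers the chord.\<close>
    have "0 \<le> (q 0 x + q 1 x) / 2 - q (1/2) x"
      using convex[of 0 1 "1/2" x] by simp
    then show ?thesis
      using \<open>0 \<le> r\<close> by (simp add: qD)
  qed
  have f_le_D: "x \<bullet> (f t *v x) \<le> x \<bullet> (D *v x)" for x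
  proof (cases "t \<le> 1/2")
    case True
    then have "r = t" using assms by simp
    \<comment> \<open>Here \<open>t\<close> lies between \<open>0\<close> and \<open>1/2\<close>,
      with weight \<open>2 * t\<close> on \<open>1/2\<close>.\<close>
    have "q t x \<le> (1 - 2 * t) * q 0 x + 2 * t * q (1/2) x"
      using convex[of 0 "1/2" "2 * t" x] True assms by simp
    also have "\<dots> = x \<bullet> (D *v x)"
      unfolding qD qC \<open>r = t\<close> by (simp add: algebra_simps)
    finally show ?thesis by (simp add: q_def)
  next
    case False
    then have "r = 1 - t" using assms by simp
    \<comment> \<open>Now \<open>t\<close> lies between \<open>1/2\<close> and \<open>1\<close>;
      measured from \<open>1\<close>, the weight on \<open>1/2\<close> is
      \<open>2 - 2 * t\<close>.\<close>
    have "(1 - (2 - 2 * t)) * 1 + (2 - 2 * t) * (1/2) = t"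
      by (simp add: algebra_simps)
    then have "q t x \<le> (1 - (2 - 2 * t)) * q 1 x + (2 - 2 * t) * q (1/2) x"
      using convex[of 1 "1/2" "2 - 2 * t" x] False assms by (simp del: mult_1_right)
    also have "\<dots> = x \<bullet> (D *v x)"
      unfolding qD qC \<open>r = 1 - t\<close> by (simp add: field_simps)
    finally show ?thesis by (simp add: q_def)
  qed
  have "hermitian (f s)" if "0 \<le> s" "s \<le> 1" for s
    using f that by (simp add: pos_def_iff)
  then have herm: "hermitian C" "hermitian D"
    unfolding C_def D_def by (simp_all add: hermitian_add hermitian_diff hermitian_scaleR)
  \<comment> \<open>\<open>D\<close> contains a subtraction, so its positivity is not evident from
    its form; it is inherited from \<open>f t\<close> through the bound just proved, and passes on
    to \<open>C\<close>.\<close>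
  have pos: "pos_def C" "pos_def D"
    using f[of t] assms herm f_le_D D_le_C unfolding pos_def_iff
    by (meson less_le_trans)+
  have "matrix_inv C = wharm_mean t (real_part A) (real_part B)"
    by (simp add: C_def endpoints wharm_mean_def)
  moreover have "D = matrix_inv (wharm_mean t (real_part A) (real_part B))
        - (2 * r) *\<^sub>R (matrix_inv (harm_mean (real_part A) (real_part B))
                       - matrix_inv (real_part (harm_mean A B)))"
    using assms by (simp add: D_def C_def wharm f_eq[symmetric])
  ultimately show ?thesis
    using matrix_inv_antimono[OF pos(2,1) D_le_C] matrix_inv_antimono[OF f[of t] pos(2) f_le_D]
      inv_f[of t] assms by simp
qed

end
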